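(* There exist a constant $\kappa > 0$ and a threshold $N$ such that for all integers $n, d \geq N$, every branching program computing $\mathrm{OV}_{n,d}$ has size at least $$\kappa \cdot \frac{\min\{n^2,\ n \cdot 2^d/d^{1/2}\}}{\log(nd)\,\log(d)}.$$ (Equivalently: for all sufficiently large $n,d$, $\mathrm{OV}_{n,d}$ does not have branching programs of size $O(\min\{n^2, n2^d/d^{1/2}\}/(\log(nd)\log d))$.)
   Context: The Orthogonal Vectors function $\mathrm{OV}_{n,d}:\{0,1\}^{nd}\to\{0,1\}$ takes $n$ vectors $v_1,\ldots,v_n \in \{0,1\}^d$ (given as $nd$ Boolean input variables) and outputs $1$ iff there exist $i,j$ with $\langle v_i,v_j\rangle = 0$ over the integers. A branching program of size $S$ on variables $x_1,\ldots,x_m$ is a directed acyclic graph on $S$ nodes with a distinguished start node and exactly two sink nodes labeled $0$ and $1$; every non-sink node is labeled by a variable $x_i$ and has two outgoing edges labeled $x_i=0$ and $x_i=1$. On input $a\in\{0,1\}^m$, one follows from the start node the edges consistent with $a$; the label of the sink reached is the output. *)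

theory Defs
  imports Complex_Main "HOL-Library.FuncSet"
begin

text \<open>
  \<open>sink b\<close> is the sink labelled \<open>b\<close>. The fields \<open>label\<close> and \<open>target\<close> are meaningful
  at inner nodes only; \<open>target P u b\<close> is the end point of the edge out of \<open>u\<close> labelled \<open>b\<close>,
  and the two edges out of a node may have the same end point.
\<close>
record ('v, 'x) bp =
  nodes :: "'v set"
  start :: "'v"
  sink :: "bool \<Rightarrow> 'v"
  label :: "'v \<Rightarrow> 'x"
  target :: "'v \<Rightarrow> bool \<Rightarrow> 'v"

definition inner_nodes :: "('v, 'x) bp \<Rightarrow> 'v set" where
  "inner_nodes P = nodes P - range (sink P)"

definition edges :: "('v, 'x) bp \<Rightarrow> 'v rel" where
  "edges P = {(u, target P u b) | u b. u \<in> inner_nodes P}"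

locale branching_program =
  fixes X :: "'x set" and P :: "('v, 'x) bp"
  assumes finite_nodes: "finite (nodes P)"
    and start_in_nodes: "start P \<in> nodes P"
    and sink_in_nodes: "sink P b \<in> nodes P"
    and sinks_distinct: "sink P False \<noteq> sink P True"
    and label_in_vars: "u \<in> inner_nodes P \<Longrightarrow> label P u \<in> X"
    and target_in_nodes: "u \<in> inner_nodes P \<Longrightarrow> target P u b \<in> nodes P"
    and acyclic_edges: "acyclic (edges P)"

definition bp_size :: "('v, 'x) bp \<Rightarrow> nat" where
  "bp_size P = card (nodes P)"

definition consistent_edges :: "('v, 'x) bp \<Rightarrow> ('x \<Rightarrow> bool) \<Rightarrow> 'v rel" where
  "consistent_edges P a = {(u, target P u (a (label P u))) | u. u \<in> inner_nodes P}"

text \<open>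
  Every inner node has exactly one consistent out-edge and sinks have none, so a branching
  program has exactly one output on each input (\<open>ex1_outputs\<close> below).
\<close>
definition outputs :: "('v, 'x) bp \<Rightarrow> ('x \<Rightarrow> bool) \<Rightarrow> bool \<Rightarrow> bool" where
  "outputs P a b \<longleftrightarrow> (start P, sink P b) \<in> (consistent_edges P a)\<^sup>*"

definition computes :: "'x set \<Rightarrow> ('v, 'x) bp \<Rightarrow> (('x \<Rightarrow> bool) \<Rightarrow> bool) \<Rightarrow> bool" where
  "computes X P f \<longleftrightarrow> (\<forall>a \<in> X \<rightarrow>\<^sub>E UNIV. outputs P a (f a))"

text \<open>The variable \<open>(i, k)\<close> is the \<open>k\<close>-th coordinate of the vector \<open>v\<^sub>i\<close>, both counted from 0.\<close>
definition OV_vars :: "nat \<Rightarrow> nat \<Rightarrow> (nat \<times> nat) set" where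
  "OV_vars n d = {..<n} \<times> {..<d}"

text \<open>The indices \<open>i = j\<close> are allowed; for \<open>n \<ge> 2\<close> requiring \<open>i \<noteq> j\<close> gives the same function.\<close>
definition OV :: "nat \<Rightarrow> nat \<Rightarrow> (nat \<times> nat \<Rightarrow> bool) \<Rightarrow> bool" where
  "OV n d a \<longleftrightarrow>
    (\<exists>i<n. \<exists>j<n. (\<Sum>k<d. of_bool (a (i, k)) * of_bool (a (j, k)) :: int) = 0)"

lemma (in branching_program) ex1_outputs: "\<exists>!b. outputs P a b"
proof -
  let ?C = "consistent_edges P a"
  have C_edges: "?C \<subseteq> edges P"
    by (auto simp: consistent_edges_def edges_def)
  have "edges P \<subseteq> nodes P \<times> nodes P"
    by (auto simp: edges_def inner_nodes_def target_in_nodes)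
  then have "finite ?C"
    using C_edges finite_nodes by (meson finite_SigmaI finite_subset)
  moreover have "acyclic ?C"
    using acyclic_edges C_edges by (rule acyclic_subset)
  ultimately have wf: "wf (?C\<inverse>)"
    by (rule finite_acyclic_wf_converse)
  have sink_stuck: "(sink P b, v) \<notin> ?C" for b v
    by (auto simp: consistent_edges_def inner_nodes_def)
  have "u \<in> nodes P \<longrightarrow> (\<exists>!b. (u, sink P b) \<in> ?C\<^sup>*)" for u
    using wf
  proof (induction u rule: wf_induct_rule)
    case (less u)
    show ?case
    proof
      assume u: "u \<in> nodes P"
      show "\<exists>!b. (u, sink P b) \<in> ?C\<^sup>*"
      proof (cases "u \<in> inner_nodes P")
        case True
        let ?v = "target P u (a (label P u))"
        have "(u, ?v) \<in> ?C"
          using True by (auto simp: consistent_edges_def)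
        moreover have "w = ?v" if "(u, w) \<in> ?C" for w
          using that by (auto simp: consistent_edges_def)
        moreover have "u \<noteq> sink P b" for b
          using True by (auto simp: inner_nodes_def)
        ultimately have "(u, sink P b) \<in> ?C\<^sup>* \<longleftrightarrow> (?v, sink P b) \<in> ?C\<^sup>*" for b
          by (metis converse_rtranclE converse_rtrancl_into_rtrancl)
        then show ?thesis
          using less.IH[of ?v] \<open>(u, ?v) \<in> ?C\<close> target_in_nodes[OF True] by simp
      next
        case False
        then obtain c where c: "u = sink P c"
          using u by (auto simp: inner_nodes_def)
        have "(u, sink P b) \<in> ?C\<^sup>* \<longleftrightarrow> b = c" for b
          using sink_stuck sinks_distinct c
          by (metis (full_types) converse_rtranclE rtrancl.rtrancl_refl)
        then show ?thesis by simp
      qed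
    qed
  qed
  then show ?thesis
    using start_in_nodes by (simp add: outputs_def)
qed

end

theory Submission
  imports Defs "HOL-Library.Disjoint_Sets"
begin

text \<open>
  Nechiporuk's method, with one block of variables per vector. Fixing the variables outside a
  block \<open>B\<close> leaves a program whose nodes are the \<open>s\<close> nodes of the block and the two sinks, so at
  most \<open>(s + 2)\<^bsup>2s + 1\<^esup>\<close> functions of the block arise in this way. For \<open>OV\<close>, put \<open>k = (d - 1) div 2\<close>
  and let the other vectors have coordinate 0 set and be, on the coordinates \<open>1, \<dots>, 2k\<close>, either
  constantly 1 or a prescribed \<open>k\<close>-subset. No two of them are orthogonal, and the vector
  complementary to a \<open>k\<close>-subset \<open>w\<close> is orthogonal to one of them iff \<open>w\<close> itself occurs. Hence every
  block has at least \<open>2\<^sup>m\<close> subfunctions with \<open>m = min (n - 1) (2k choose k)\<close>.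
\<close>

section \<open>Nechiporuk's bound\<close>

definition block_nodes :: "('v, 'x) bp \<Rightarrow> 'x set \<Rightarrow> 'v set" where
  "block_nodes P B = {u \<in> inner_nodes P. label P u \<in> B}"

definition bypass_edges :: "('v, 'x) bp \<Rightarrow> 'x set \<Rightarrow> ('x \<Rightarrow> bool) \<Rightarrow> 'v rel" where
  "bypass_edges P B a = {(u, v) \<in> consistent_edges P a. label P u \<notin> B}"

text \<open>The node at which a computation from \<open>u\<close> next queries the block or halts; a
  node that already does so is its own bypass. The choice depends on \<open>a\<close> only through
  the edge relation, hence only on the values outside \<open>B\<close>.\<close>

definition bypass :: "('v, 'x) bp \<Rightarrow> 'x set \<Rightarrow> ('x \<Rightarrow> bool) \<Rightarrow> 'v \<Rightarrow> 'v" where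
  "bypass P B a u =
    (SOME w. w \<in> block_nodes P B \<union> range (sink P) \<and> (u, w) \<in> (bypass_edges P B a)\<^sup>*)"

lemma bypass_cong: "(\<And>x. x \<notin> B \<Longrightarrow> a x = a' x) \<Longrightarrow> bypass P B a = bypass P B a'"
proof -
  assume eq: "\<And>x. x \<notin> B \<Longrightarrow> a x = a' x"
  then have "bypass_edges P B a = bypass_edges P B a'"
    by (auto simp: bypass_edges_def consistent_edges_def)
  then show ?thesis
    by (simp add: bypass_def fun_eq_iff)
qed

context branching_program
begin

lemma finite_inner_nodes: "finite (inner_nodes P)"
  using finite_nodes by (simp add: inner_nodes_def)

lemma finite_block_nodes: "finite (block_nodes P B)"
  using finite_inner_nodes by (simp add: block_nodes_def)

lemma consistent_edges_subset_edges: "consistent_edges P a \<subseteq> edges P"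
  by (auto simp: consistent_edges_def edges_def)

lemma wf_edges: "wf ((edges P)\<inverse>)"
proof -
  have "edges P \<subseteq> nodes P \<times> nodes P"
    by (auto simp: edges_def inner_nodes_def target_in_nodes)
  then have "finite (edges P)"
    using finite_nodes by (meson finite_SigmaI finite_subset)
  then show ?thesis
    using acyclic_edges by (rule finite_acyclic_wf_converse)
qed

text \<open>The choice has a witness: at any other node the consistent edge is a bypass edge, and
  acyclicity ends the walk.\<close>

lemma bypass:
  assumes "u \<in> nodes P"
  shows "bypass P B a u \<in> block_nodes P B \<union> range (sink P)"
    and "(u, bypass P B a u) \<in> (consistent_edges P a)\<^sup>*"
proof -
  have "\<exists>w. w \<in> block_nodes P B \<union> range (sink P) \<and> (u, w) \<in> (bypass_edges P B a)\<^sup>*"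
    using wf_edges assms
  proof (induction u rule: wf_induct_rule)
    case (less u)
    show ?case
    proof (cases "u \<in> block_nodes P B \<union> range (sink P)")
      case True
      then show ?thesis by (intro exI[of _ u]) simp
    next
      case False
      then have u: "u \<in> inner_nodes P" "label P u \<notin> B"
        using less.prems by (auto simp: block_nodes_def inner_nodes_def)
      let ?v = "target P u (a (label P u))"
      have edge: "(u, ?v) \<in> bypass_edges P B a"
        using u by (auto simp: bypass_edges_def consistent_edges_def)
      then have "(?v, u) \<in> (edges P)\<inverse>"
        using consistent_edges_subset_edges by (auto simp: bypass_edges_def)
      then show ?thesis
        using less.IH target_in_nodes[OF u(1)] edge by (meson converse_rtrancl_into_rtrancl)
    qed
  qed
  then have *: "bypass P B a u \<in> block_nodes P B \<union> range (sink P) \<and>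
      (u, bypass P B a u) \<in> (bypass_edges P B a)\<^sup>*"
    unfolding bypass_def by (rule someI_ex)
  then show "bypass P B a u \<in> block_nodes P B \<union> range (sink P)" by blast
  have "bypass_edges P B a \<subseteq> consistent_edges P a"
    by (auto simp: bypass_edges_def)
  then show "(u, bypass P B a u) \<in> (consistent_edges P a)\<^sup>*"
    using * rtrancl_mono by blast
qed

text \<open>A computation is a sequence of jumps: answer a query in the block, then bypass to the
  next one. Both inputs give the same answers and the same bypasses, so they visit the same block
  nodes and halt at the same sink.\<close>

lemma block_nodes_reach_same_sink:
  assumes agree: "\<And>x. x \<in> B \<Longrightarrow> a x = a' x"
    and targets: "\<And>u b. u \<in> block_nodes P B \<Longrightarrow>
      bypass P B a (target P u b) = bypass P B a' (target P u b)"
    and "w \<in> block_nodes P B \<union> range (sink P)"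
  shows "\<exists>b. (w, sink P b) \<in> (consistent_edges P a)\<^sup>* \<and> (w, sink P b) \<in> (consistent_edges P a')\<^sup>*"
  \<comment> \<open>One jump may cross many edges, so the induction runs over the transitive
    closure.\<close>
  using wf_trancl[OF wf_edges] assms(3)
proof (induction w rule: wf_induct_rule)
  case (less w)
  show ?case
  proof (cases "w \<in> block_nodes P B")
    case True
    then have w: "w \<in> inner_nodes P" "label P w \<in> B"
      by (auto simp: block_nodes_def)
    let ?v = "target P w (a (label P w))"
    let ?w = "bypass P B a ?v"
    have v: "?v \<in> nodes P" using w(1) by (rule target_in_nodes)
    have edge: "(w, ?v) \<in> consistent_edges P a" "(w, ?v) \<in> consistent_edges P a'"
      using w agree by (auto simp: consistent_edges_def)
    have path: "(w, ?w) \<in> (consistent_edges P a)\<^sup>+" "(w, ?w) \<in> (consistent_edges P a')\<^sup>+"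
      using edge bypass(2)[OF v, of B a] bypass(2)[OF v, of B a'] targets[OF True]
      by (metis rtrancl_into_trancl2)+
    have "(w, ?w) \<in> (edges P)\<^sup>+"
      using path(1) consistent_edges_subset_edges by (rule trancl_mono)
    then have "(?w, w) \<in> ((edges P)\<inverse>)\<^sup>+"
      by (simp add: trancl_converse)
    then obtain b where "(?w, sink P b) \<in> (consistent_edges P a)\<^sup>*"
        "(?w, sink P b) \<in> (consistent_edges P a')\<^sup>*"
      using less.IH bypass(1)[OF v] by blast
    then show ?thesis
      using path by (meson rtrancl_trans trancl_into_rtrancl)
  next
    case False
    then show ?thesis using less.prems by blast
  qed
qed

text \<open>The start node may lie outside the block, so its bypass must agree as well; uniqueness
  of the output then gives the claim.\<close>

lemma outputs_eq_if_bypass_eq: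
  assumes agree: "\<And>x. x \<in> B \<Longrightarrow> a x = a' x"
    and "bypass P B a (start P) = bypass P B a' (start P)"
    and "\<And>u b. u \<in> block_nodes P B \<Longrightarrow>
      bypass P B a (target P u b) = bypass P B a' (target P u b)"
    and "outputs P a c" and "outputs P a' c'"
  shows "c = c'"
proof -
  obtain b where b: "(bypass P B a (start P), sink P b) \<in> (consistent_edges P a)\<^sup>*"
      "(bypass P B a (start P), sink P b) \<in> (consistent_edges P a')\<^sup>*"
    using block_nodes_reach_same_sink[OF agree assms(3)] bypass(1)[OF start_in_nodes] by metis
  then have "outputs P a b" "outputs P a' b"
    using bypass(2)[OF start_in_nodes] assms(2) by (metis outputs_def rtrancl_trans)+
  then show ?thesis using assms(4,5) ex1_outputs by metis
qed

text \<open>The subfunction left by \<open>\<rho> t\<close> is determined by the bypasses of the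
  start node and of the two targets of each block node. These are \<open>2s + 1\<close> values out
  of at most \<open>s + 2\<close>, where \<open>s\<close> is the number of block nodes.\<close>

theorem nechiporuk:
  assumes comp: "computes X P f"
    and "B \<subseteq> X"
    and \<rho>: "\<And>t. t \<in> T \<Longrightarrow> \<rho> t \<in> X \<rightarrow>\<^sub>E UNIV"
    and separated: "\<And>t t'. t \<in> T \<Longrightarrow> t' \<in> T \<Longrightarrow> t \<noteq> t' \<Longrightarrow>
      \<exists>v. f (override_on (\<rho> t) v B) \<noteq> f (override_on (\<rho> t') v B)"
  shows "card T \<le> (card (block_nodes P B) + 2) ^ (2 * card (block_nodes P B) + 1)"
proof -
  let ?U = "block_nodes P B"
  let ?W = "?U \<union> range (sink P)"
  let ?F = "(?U \<times> (UNIV :: bool set)) \<rightarrow>\<^sub>E ?W"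
  define key where "key t = (bypass P B (\<rho> t) (start P),
      restrict (\<lambda>(u, b). bypass P B (\<rho> t) (target P u b)) (?U \<times> UNIV))" for t
  have fin: "finite ?W" using finite_block_nodes by simp
  have "inj_on key T"
  proof (rule inj_onI, rule ccontr)
    fix t t' assume t: "t \<in> T" "t' \<in> T" and key: "key t = key t'" and "t \<noteq> t'"
    then obtain v where v: "f (override_on (\<rho> t) v B) \<noteq> f (override_on (\<rho> t') v B)"
      using separated by blast
    have out: "outputs P (override_on (\<rho> s) v B) (f (override_on (\<rho> s) v B))" if "s \<in> T" for s
    proof -
      have "override_on (\<rho> s) v B \<in> X \<rightarrow>\<^sub>E UNIV"
        using \<rho>[OF that] \<open>B \<subseteq> X\<close> by (auto simp: override_on_def PiE_def extensional_def)
      then show ?thesis using comp by (simp add: computes_def)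
    qed
    \<comment> \<open>The key is computed before the block is filled in and stays valid for every
      filling \<open>v\<close>.\<close>
    have byp: "bypass P B (override_on (\<rho> s) v B) = bypass P B (\<rho> s)" for s
      by (rule bypass_cong) simp
    have "bypass P B (\<rho> t) (target P u b) = bypass P B (\<rho> t') (target P u b)" if "u \<in> ?U" for u b
      using that key by (auto simp: key_def restrict_def fun_eq_iff split: if_splits)
    then have "f (override_on (\<rho> t) v B) = f (override_on (\<rho> t') v B)"
      using key t
      by (intro outputs_eq_if_bypass_eq[OF _ _ _ out out, of B]) (auto simp: byp key_def)
    with v show False by simp
  qed
  moreover have "key ` T \<subseteq> ?W \<times> ?F"
  proof -
    have "target P u b \<in> nodes P" if "u \<in> ?U" for u b
      using that target_in_nodes by (simp add: block_nodes_def)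
    then have "bypass P B (\<rho> t) (target P u b) \<in> ?W" if "u \<in> ?U" for t u b
      using that by (intro bypass(1))
    then show ?thesis
      unfolding key_def using bypass(1)[OF start_in_nodes]
      by (intro image_subsetI SigmaI restrict_PiE_iff[THEN iffD2]) auto
  qed
  moreover have "finite (?W \<times> ?F)"
    using fin finite_block_nodes by (intro finite_cartesian_product finite_PiE) auto
  ultimately have "card T \<le> card (?W \<times> ?F)"
    by (rule card_inj_on_le)
  also have "\<dots> = card ?W ^ (2 * card ?U + 1)"
    using finite_block_nodes by (simp add: card_cartesian_product card_PiE mult.commute)
  also have "card ?W \<le> card ?U + 2"
  proof -
    have "card (range (sink P)) \<le> 2"
      using card_image_le[of "UNIV :: bool set" "sink P"] by simp
    then show ?thesis using card_Un_le[of ?U "range (sink P)"] by linarith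
  qed
  then have "card ?W ^ (2 * card ?U + 1) \<le> (card ?U + 2) ^ (2 * card ?U + 1)"
    by (rule power_mono) simp
  finally show ?thesis .
qed

text \<open>A node has a single label, so it is counted for at most one of the disjoint
  blocks.\<close>

lemma sum_block_nodes_le_size:
  assumes "finite I" and "disjoint_family_on B I"
  shows "(\<Sum>i\<in>I. card (block_nodes P (B i))) \<le> bp_size P"
proof -
  have "(\<Sum>i\<in>I. card (block_nodes P (B i))) = card (\<Union>i\<in>I. block_nodes P (B i))"
    using assms finite_block_nodes
    by (intro card_UN_disjoint[symmetric]) (auto simp: block_nodes_def disjoint_family_on_def)
  also have "\<dots> \<le> card (nodes P)"
    by (intro card_mono finite_nodes) (auto simp: block_nodes_def inner_nodes_def)
  finally show ?thesis by (simp add: bp_size_def)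
qed

end

section \<open>Subfunctions of orthogonal vectors\<close>

lemma OV_iff:
  "OV n d a \<longleftrightarrow> (\<exists>i<n. \<exists>j<n. \<forall>l<d. \<not> (a (i, l) \<and> a (j, l)))"
proof -
  have "(\<Sum>l<d. of_bool (a (i, l)) * of_bool (a (j, l)) :: int) = 0 \<longleftrightarrow>
      (\<forall>l<d. \<not> (a (i, l) \<and> a (j, l)))" for i j
    by (subst sum_nonneg_eq_0_iff) auto
  then show ?thesis by (simp add: OV_def)
qed

text \<open>The restrictions are indexed by the subsets \<open>S\<close> of an \<open>m\<close>-set
  \<open>J\<close> of other vectors. If \<open>j\<close> lies in exactly one of \<open>S\<close> and
  \<open>S'\<close>, the complement of \<open>g j\<close>, placed in block \<open>i\<close>,
  separates the two.\<close>

lemma OV_block_nodes_bound: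
  assumes bp: "branching_program (OV_vars n d) P"
    and comp: "computes (OV_vars n d) P (OV n d)"
    and "i < n" and k: "k \<ge> 1" "2 * k < d"
    and m: "m \<le> n - 1" "m \<le> 2 * k choose k"
  defines "s \<equiv> card (block_nodes P ({i} \<times> {..<d}))"
  shows "2 ^ m \<le> (s + 2) ^ (2 * s + 1)"
proof -
  interpret branching_program "OV_vars n d" P by (rule bp)
  define F where "F = {w. w \<subseteq> {1..2 * k} \<and> card w = k}"
  have "card ({..<n} - {i}) = n - 1" using \<open>i < n\<close> by simp
  then obtain J where J: "J \<subseteq> {..<n} - {i}" "card J = m" "finite J"
    using m(1) by (metis obtain_subset_with_card_n)
  have "finite F" by (simp add: F_def)
  moreover have "card F = 2 * k choose k"
    using n_subsets[of "{1..2 * k}" k] by (simp add: F_def)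
  ultimately obtain g where g: "g ` J \<subseteq> F" "inj_on g J"
    using card_le_inj[of J F] J m(2) by auto
  \<comment> \<open>Rows outside \<open>S\<close> are constantly 1, rows in \<open>S\<close> are the
    indicator of \<open>g j\<close> together with coordinate 0.\<close>
  define \<rho> where "\<rho> S = restrict (\<lambda>(j, l). j \<in> S \<longrightarrow> l = 0 \<or> l \<in> g j) (OV_vars n d)" for S
  define v where "v j = (\<lambda>(i' :: nat, l). l \<in> {1..2 * k} - g j)" for j
  have OV_iff_mem: "OV n d (override_on (\<rho> S) (v j) ({i} \<times> {..<d})) \<longleftrightarrow> j \<in> S"
    if S: "S \<subseteq> J" and j: "j \<in> J" for S j
  proof -
    define a where "a = override_on (\<rho> S) (v j) ({i} \<times> {..<d})"
    have a_i: "a (i, l) \<longleftrightarrow> l \<in> {1..2 * k} - g j" if "l < d" for l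
      using that by (simp add: a_def v_def)
    have a_other: "a (p, l) \<longleftrightarrow> (p \<in> S \<longrightarrow> l = 0 \<or> l \<in> g p)" if "p < n" "p \<noteq> i" "l < d" for p l
      using that by (simp add: a_def \<rho>_def OV_vars_def override_on_def)
    have gF: "g p \<subseteq> {1..2 * k}" "card (g p) = k" "finite (g p)" if "p \<in> J" for p
      using g(1) that finite_subset[of "g p" "{1..2 * k}"] by (auto simp: F_def)
    \<comment> \<open>As \<open>k \<ge> 1\<close>, row \<open>i\<close> is nonzero, so it is
      orthogonal neither to itself nor to a constant 1 row.\<close>
    have "card ({1..2 * k} - g j) = k"
      using gF[OF j] by (simp add: card_Diff_subset)
    then obtain l0 where l0: "l0 \<in> {1..2 * k} - g j"
      using k(1) by (metis card.empty ex_in_conv not_one_le_zero)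
    then have l0d: "l0 < d" using k(2) by simp
    have meets: "\<exists>l<d. a (i, l) \<and> a (p, l)" if p: "p < n" and not: "\<not> (p = j \<and> j \<in> S)" for p
    proof (cases "p \<in> S \<and> p \<noteq> i")
      case False
      then have "a (p, l0)"
        using a_i[OF l0d] a_other[OF p _ l0d] l0 by (cases "p = i") auto
      then show ?thesis using a_i[OF l0d] l0 l0d by blast
    next
      case True
      then have pJ: "p \<in> J" and "p \<noteq> j" using S not by auto
      \<comment> \<open>Sets of equal size form an antichain, so \<open>g p\<close> meets the
        complement of \<open>g j\<close> whenever \<open>p \<noteq> j\<close>.\<close>
      have "\<not> g p \<subseteq> g j"
      proof
        assume "g p \<subseteq> g j"
        then have "g p = g j" using gF[OF pJ] gF[OF j] by (simp add: card_subset_eq)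
        then show False using g(2) pJ j \<open>p \<noteq> j\<close> by (meson inj_onD)
      qed
      then obtain l where l: "l \<in> g p" "l \<notin> g j" by blast
      then have "l \<in> {1..2 * k} - g j" "l < d" using gF(1)[OF pJ] k(2) by fastforce+
      then show ?thesis using a_i a_other[OF p] True l by blast
    qed
    have "OV n d a \<longleftrightarrow> j \<in> S"
    proof
      assume "j \<in> S"
      have jn: "j < n" "j \<noteq> i" using j J by auto
      have "\<not> (a (i, l) \<and> a (j, l))" if "l < d" for l
        using a_i[OF that] a_other[OF jn that] \<open>j \<in> S\<close> by auto
      then show "OV n d a" unfolding OV_iff using \<open>i < n\<close> jn by blast
    next
      assume "OV n d a"
      then obtain p q where pq: "p < n" "q < n" "\<And>l. l < d \<Longrightarrow> \<not> (a (p, l) \<and> a (q, l))"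
        unfolding OV_iff by blast
      \<comment> \<open>All rows other than \<open>i\<close> share coordinate 0, so an orthogonal
        pair must involve row \<open>i\<close>.\<close>
      have "0 < d" using k by simp
      then have "p = i \<or> q = i"
        using pq a_other[of p 0] a_other[of q 0] by blast
      then show "j \<in> S" using pq meets by blast
    qed
    then show ?thesis by (simp only: a_def)
  qed
  have "card (Pow J) \<le> (s + 2) ^ (2 * s + 1)"
    unfolding s_def
  proof (rule nechiporuk[OF comp])
    show "{i} \<times> {..<d} \<subseteq> OV_vars n d" using \<open>i < n\<close> by (auto simp: OV_vars_def)
    show "\<rho> S \<in> OV_vars n d \<rightarrow>\<^sub>E UNIV" for S by (simp add: \<rho>_def)
    fix S S' assume "S \<in> Pow J" "S' \<in> Pow J" "S \<noteq> S'"
    then obtain j where "j \<in> J" "(j \<in> S) \<noteq> (j \<in> S')" "S \<subseteq> J" "S' \<subseteq> J" by blast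
    then show "\<exists>v. OV n d (override_on (\<rho> S) v ({i} \<times> {..<d})) \<noteq>
        OV n d (override_on (\<rho> S') v ({i} \<times> {..<d}))"
      using OV_iff_mem by blast
  qed
  then show ?thesis using J by (simp add: card_Pow)
qed

section \<open>Estimates\<close>

text \<open>The squared form \<open>16 ^ k \<le> 4 * k * c\<^sup>2\<close> is an equality at
  \<open>k = 1\<close>. It is inductive by the recurrence
  \<open>(k + 1) * c' = 2 * (2 * k + 1) * c\<close> and
  \<open>4 * k * (k + 1) \<le> (2 * k + 1)\<^sup>2\<close>.\<close>

lemma central_binomial_ge_sqrt:
  assumes "k \<ge> 1"
  shows "4 ^ k / (2 * sqrt (real k)) \<le> real (2 * k choose k)"
proof -
  have "16 ^ k \<le> 4 * real k * (real (2 * k choose k))\<^sup>2"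
    using assms
  proof (induction k rule: dec_induct)
    case base
    then show ?case by simp
  next
    case (step k)
    let ?c = "real (2 * k choose k)" and ?c' = "real (2 * Suc k choose Suc k)"
    have "Suc k * (2 * Suc k choose Suc k) = 2 * (2 * k + 1) * (2 * k choose k)"
    proof -
      have "Suc k * (2 * Suc k choose Suc k) = 2 * Suc k * (Suc (2 * k) choose k)"
        using Suc_times_binomial[of k "Suc (2 * k)"] by simp
      also have "Suc (2 * k) choose k = Suc (2 * k) choose Suc k"
        using binomial_symmetric[of k "Suc (2 * k)"] by (simp add: Suc_diff_le)
      also have "2 * Suc k * \<dots> = 2 * (Suc (2 * k) * (2 * k choose k))"
        using Suc_times_binomial[of k "2 * k"] by simp
      finally show ?thesis by simp
    qed
    then have "real (Suc k * (2 * Suc k choose Suc k)) = real (2 * (2 * k + 1) * (2 * k choose k))"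
      by (simp only:)
    then have rec: "(real k + 1) * ?c' = 2 * (2 * real k + 1) * ?c"
      by (simp add: algebra_simps)
    have "16 ^ Suc k * real (k + 1) \<le> 16 * (4 * k * ?c\<^sup>2) * real (k + 1)"
      using step.IH by (intro mult_right_mono) auto
    also have "\<dots> = 16 * (4 * real k * (k + 1)) * ?c\<^sup>2"
      by (simp add: algebra_simps)
    also have "\<dots> \<le> 16 * (2 * real k + 1)\<^sup>2 * ?c\<^sup>2"
      by (intro mult_right_mono mult_left_mono) (auto simp: power2_eq_square algebra_simps)
    also have "\<dots> = 4 * (2 * (2 * real k + 1) * ?c)\<^sup>2"
      by (simp add: power2_eq_square algebra_simps)
    also have "\<dots> = 4 * ((real k + 1) * ?c')\<^sup>2"
      by (simp only: rec)
    also have "\<dots> = (4 * real (Suc k) * ?c'\<^sup>2) * real (k + 1)"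
      by (simp add: power_mult_distrib power2_eq_square algebra_simps)
    finally show ?case
      by (rule mult_right_le_imp_le) simp
  qed
  then have "sqrt (16 ^ k) \<le> sqrt (4 * real k * (real (2 * k choose k))\<^sup>2)"
    by simp
  moreover have "sqrt (16 ^ k) = 4 ^ k"
    using real_sqrt_unique[of "4 ^ k" "16 ^ k"]
    by (simp add: power2_eq_square flip: power_mult_distrib)
  ultimately have "4 ^ k \<le> 2 * sqrt (real k) * real (2 * k choose k)"
    by (simp add: real_sqrt_mult)
  then show ?thesis
    using assms by (simp add: divide_simps mult.commute)
qed

text \<open>With \<open>k = (d - 1) div 2\<close>, rounding costs a factor of at most 4, since
  \<open>d \<le> 2 * k + 2\<close>; the other factor 2 comes from
  \<open>central_binomial_ge_sqrt\<close>.\<close>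

lemma binomial_bound:
  assumes "d \<ge> 3"
  shows "2 ^ d / sqrt (real d) \<le> 8 * real (2 * ((d - 1) div 2) choose ((d - 1) div 2))"
proof -
  let ?k = "(d - 1) div 2"
  have k: "?k \<ge> 1" "d \<le> 2 * ?k + 2" "?k \<le> d" using assms by auto
  have "(2::real) ^ d \<le> 2 ^ (2 * ?k + 2)"
    using k by (intro power_increasing) auto
  also have "\<dots> = 4 * 4 ^ ?k"
    by (simp add: power_add power_mult)
  finally have "2 ^ d / sqrt (real d) \<le> 4 * 4 ^ ?k / sqrt (real ?k)"
    using k by (intro frac_le) auto
  also have "\<dots> = 8 * (4 ^ ?k / (2 * sqrt (real ?k)))"
    by simp
  also have "\<dots> \<le> 8 * real (2 * ?k choose ?k)"
    using central_binomial_ge_sqrt[OF k(1)] by simp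
  finally show ?thesis .
qed

text \<open>If \<open>s + 2 \<le> c\<close>, take logarithms and use
  \<open>2 * s + 1 \<le> 3 * s\<close>. Otherwise \<open>m + 1 \<le> c < s + 2\<close> already gives
  \<open>m \<le> s\<close>.\<close>

lemma le_of_power_bound:
  fixes s m :: nat and c :: real
  assumes bound: "2 ^ m \<le> (s + 2) ^ (2 * s + 1)"
    and "m \<ge> 2" and "c \<ge> 2" and "real m + 1 \<le> c"
  shows "real m \<le> 3 * real s * log 2 c"
proof -
  \<comment> \<open>For \<open>s = 0\<close> the bound would read \<open>2 ^ m \<le> 2\<close>,
    against \<open>m \<ge> 2\<close>.\<close>
  have "s \<noteq> 0"
  proof
    assume "s = 0"
    moreover have "(2::nat) ^ 2 \<le> 2 ^ m" using \<open>m \<ge> 2\<close> by (intro power_increasing) auto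
    ultimately show False using bound by simp
  qed
  have log: "log 2 c \<ge> 1" using \<open>c \<ge> 2\<close> by simp
  show ?thesis
  proof (cases "real (s + 2) \<le> c")
    case True
    have "real (2 ^ m) \<le> real ((s + 2) ^ (2 * s + 1))"
      using bound by (simp only: of_nat_le_iff)
    then have "log 2 (2 ^ m) \<le> log 2 (real (s + 2) ^ (2 * s + 1))"
      by (subst log_le_cancel_iff) (auto simp: add_pos_nonneg simp del: power_Suc)
    then have "real m \<le> real (2 * s + 1) * log 2 (real (s + 2))"
      by (simp add: log_nat_power del: power_Suc of_nat_add)
    also have "\<dots> \<le> (3 * real s) * log 2 c"
      using True \<open>s \<noteq> 0\<close> by (intro mult_mono) auto
    finally show ?thesis .
  next
    case False
    then have "real m \<le> 3 * real s * 1" using \<open>real m + 1 \<le> c\<close> \<open>s \<noteq> 0\<close> by simp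
    also have "\<dots> \<le> 3 * real s * log 2 c" using log by (intro mult_left_mono) auto
    finally show ?thesis .
  qed
qed

text \<open>The constant 24 is the 8 of \<open>binomial_bound\<close> times the 3 of
  \<open>le_of_power_bound\<close>. The threshold 3 ensures \<open>k \<ge> 1\<close> and
  \<open>m \<ge> 2\<close>.\<close>

theorem theorem1p2:
  shows "\<exists>\<kappa>::real. \<kappa> > 0 \<and> (\<exists>N::nat. \<forall>n d. n \<ge> N \<longrightarrow> d \<ge> N \<longrightarrow>
    (\<forall>P :: (nat, nat \<times> nat) bp.
      branching_program (OV_vars n d) P \<longrightarrow> computes (OV_vars n d) P (OV n d) \<longrightarrow>
      real (bp_size P) \<ge>
        \<kappa> * (min ((real n)\<^sup>2) (real n * 2 ^ d / sqrt (real d))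
              / (log 2 (real n * real d) * log 2 (real d)))))"
proof (intro exI[of _ "1 / 24 :: real"] conjI exI[of _ "3 :: nat"] allI impI)
  fix n d :: nat and P :: "(nat, nat \<times> nat) bp"
  assume n: "n \<ge> 3" and d: "d \<ge> 3"
    and bp: "branching_program (OV_vars n d) P" and comp: "computes (OV_vars n d) P (OV n d)"
  define k where "k = (d - 1) div 2"
  define m where "m = min (n - 1) (2 * k choose k)"
  define L where "L = log 2 (real n * real d)"
  define s where "s i = card (block_nodes P ({i} \<times> {..<d}))" for i
  let ?M = "min ((real n)\<^sup>2) (real n * 2 ^ d / sqrt (real d))"
  have k: "k \<ge> 1" "2 * k < d" using d by (auto simp: k_def)
  have nd: "real n * 3 \<le> real n * real d"
    using d by (intro mult_left_mono) auto
  then have nd2: "real n * real d \<ge> 2" using n by linarith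
  then have L: "L \<ge> 1" by (simp add: L_def)
  have "2 * k choose k \<ge> 2"
    using binomial_mono[of 1 k "2 * k"] k(1) by simp
  then have m2: "m \<ge> 2" using n by (simp add: m_def)
  have block: "real m \<le> 3 * real (s i) * L" if "i < n" for i
    unfolding L_def
  proof (rule le_of_power_bound)
    show "2 ^ m \<le> (s i + 2) ^ (2 * s i + 1)"
      unfolding s_def by (rule OV_block_nodes_bound[OF bp comp that k]) (simp_all add: m_def)
    show "real m + 1 \<le> real n * real d"
    proof -
      have "m + 1 \<le> n" using n by (simp add: m_def)
      then have "real m + 1 \<le> real n" by linarith
      then show ?thesis using nd by linarith
    qed
  qed (use m2 nd2 in auto)
  have "?M \<le> real n * (8 * real m)"
  proof -
    \<comment> \<open>The factor 8 is dictated by the binomial term and more than covers the passage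
      from \<open>n\<close> to \<open>n - 1\<close>.\<close>
    have "(real n)\<^sup>2 \<le> real n * (8 * real (n - 1))"
      unfolding power2_eq_square using n by (intro mult_left_mono) auto
    moreover have "real n * 2 ^ d / sqrt (real d) \<le> real n * (8 * real (2 * k choose k))"
      using mult_left_mono[OF binomial_bound[OF d], of "real n"] by (simp add: k_def)
    moreover have "m = n - 1 \<or> m = 2 * k choose k" by (auto simp: m_def)
    ultimately show ?thesis by (metis min.coboundedI1 min.coboundedI2)
  qed
  also have "real n * (8 * real m) = 8 * (\<Sum>i<n. real m)" by simp
  also have "\<dots> \<le> 8 * (\<Sum>i<n. 3 * real (s i) * L)"
    using block by (intro mult_left_mono sum_mono) auto
  also have "\<dots> = 24 * L * real (\<Sum>i<n. s i)"
    by (simp add: sum_distrib_left algebra_simps)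
  also have "\<dots> \<le> 24 * L * real (bp_size P)"
    unfolding s_def using L
    by (intro mult_left_mono of_nat_mono branching_program.sum_block_nodes_le_size[OF bp])
      (auto simp: disjoint_family_on_def)
  finally have main: "?M \<le> 24 * L * real (bp_size P)" .
  \<comment> \<open>Multiplying the right-hand side of \<open>main\<close> by this factor only
    weakens the bound.\<close>
  have "log 2 (real d) \<ge> 1" using d by simp
  then have "24 * L * real (bp_size P) * 1 \<le> 24 * L * real (bp_size P) * log 2 (real d)"
    using L by (intro mult_left_mono) auto
  then have "?M \<le> 24 * real (bp_size P) * (L * log 2 (real d))"
    using main by (simp add: algebra_simps)
  moreover have "L * log 2 (real d) > 0"
    using L \<open>log 2 (real d) \<ge> 1\<close> by simp
  ultimately have "?M / (L * log 2 (real d)) \<le> 24 * real (bp_size P)"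
    by (simp add: pos_divide_le_eq)
  then show "1 / 24 * (?M / (log 2 (real n * real d) * log 2 (real d))) \<le> real (bp_size P)"
    by (simp add: L_def)
qed simp

end
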